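(* For each $n\ge 1$ and $x\in\mathbb{R}$, let $f_j(z)=z^j/\sqrt{j!}$ for $j=0,1,\dots,n$, and let $$g_n(x)=\frac{\sqrt{\left(\sum_{j=0}^n f_j'(x)^2\right)\left(\sum_{j=0}^n f_j(x)^2\right)-\left(\sum_{j=0}^n f_j(x)f_j'(x)\right)^2}}{\pi\sum_{j=0}^n f_j(x)^2}.$$ Then for every $x\in\mathbb{R}$, $$\lim_{n\to\infty} g_n(x)=\frac{1}{\pi}.$$
   Context: The function $g_n$ is the density on the real line of the expected number of real zeros of the random Weyl polynomial $\sum_{j=0}^n \eta_j z^j/\sqrt{j!}$ with $\eta_0,\dots,\eta_n$ independent identically distributed $N(0,1)$ random variables. Primes denote derivatives, and the square root is the nonnegative one. *)

theory Defs
  imports Complex_Main "HOL-Analysis.Derivative"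
begin

definition weyl_f :: "nat \<Rightarrow> real \<Rightarrow> real" where
  "weyl_f j z = z ^ j / sqrt (fact j)"

definition weyl_g :: "nat \<Rightarrow> real \<Rightarrow> real" where
  "weyl_g n x =
     sqrt ((\<Sum>j=0..n. (deriv (weyl_f j) x)\<^sup>2) * (\<Sum>j=0..n. (weyl_f j x)\<^sup>2)
           - (\<Sum>j=0..n. weyl_f j x * deriv (weyl_f j) x)\<^sup>2)
     / (pi * (\<Sum>j=0..n. (weyl_f j x)\<^sup>2))"

end

theory Submission
  imports Defs
begin

text \<open>For fixed \<open>x\<close> everything in \<open>weyl_g\<close> is continuous in the
  three sums, and the limit of the denominator is nonzero, so it suffices to insert their limits:
  \<open>weyl_f_sq_sums\<close>, \<open>weyl_f_deriv_sums\<close> and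
  \<open>deriv_weyl_f_sq_sums\<close>. In the discriminant the terms with a factor \<open>x\<close>
  cancel, and its root cancels the exponential below.\<close>

text \<open>Put t = x^2. The three sums are partial sums of exponential series in t and converge to
  exp t, x * exp t and (t + 1) * exp t, so the discriminant converges to (exp t)^2.\<close>

lemma deriv_weyl_f: "deriv (weyl_f j) x = real j * x ^ (j - 1) / sqrt (fact j)"
proof (rule DERIV_imp_deriv)
  have "((\<lambda>z. z ^ j / sqrt (fact j)) has_field_derivative
      real j * x ^ (j - 1) / sqrt (fact j)) (at x)"
    using DERIV_cdivide[OF DERIV_pow[of j x], of "sqrt (fact j)"] by simp
  then show "(weyl_f j has_field_derivative real j * x ^ (j - 1) / sqrt (fact j)) (at x)"
    by (simp add: weyl_f_def[abs_def])
qed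

lemma exp_sums: "(\<lambda>i. t ^ i / fact i) sums exp (t::real)"
  using exp_converges[of t] by (simp add: divide_inverse scaleR_conv_of_real mult.commute)

lemma weyl_f_sq_sums: "(\<lambda>j. (weyl_f j x)\<^sup>2) sums exp (x\<^sup>2)"
  using exp_sums[of "x\<^sup>2"]
  by (simp add: weyl_f_def power_divide power_mult[symmetric] mult.commute)

text \<open>The term at 0 vanishes; in the others the factor \<open>Suc i\<close> from
  differentiation cancels against \<open>fact (Suc i)\<close>, leaving \<open>x\<close> times an
  exponential series.\<close>

lemma weyl_f_deriv_sums: "(\<lambda>j. weyl_f j x * deriv (weyl_f j) x) sums (x * exp (x\<^sup>2))"
proof -
  have "weyl_f (Suc i) x * deriv (weyl_f (Suc i)) x = x * ((x\<^sup>2) ^ i / fact i)" for i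
    by (simp add: weyl_f_def deriv_weyl_f divide_simps power2_eq_square power_mult_distrib
        del: of_nat_Suc)
  then have "(\<lambda>i. weyl_f (Suc i) x * deriv (weyl_f (Suc i)) x) sums (x * exp (x\<^sup>2))"
    using sums_mult[OF exp_sums[of "x\<^sup>2"], of x] by simp
  from sums_Suc[OF this] show ?thesis
    by (simp add: deriv_weyl_f)
qed

text \<open>Here only one of the two factors \<open>Suc i\<close> cancels. Splitting the other as
  \<open>i + 1\<close> gives the series of t * exp t and of exp t.\<close>

lemma deriv_weyl_f_sq_sums: "(\<lambda>j. (deriv (weyl_f j) x)\<^sup>2) sums ((x\<^sup>2 + 1) * exp (x\<^sup>2))"
proof -
  define t where "t = x\<^sup>2"
  have "real (Suc i) * (t ^ Suc i / fact (Suc i)) = t * (t ^ i / fact i)" for i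
    by (simp add: divide_simps del: of_nat_Suc)
  then have "(\<lambda>i. real (Suc i) * (t ^ Suc i / fact (Suc i))) sums (t * exp t)"
    using sums_mult[OF exp_sums[of t], of t] by simp
  from sums_Suc[OF this] have "(\<lambda>i. real i * (t ^ i / fact i)) sums (t * exp t)"
    by simp
  from sums_add[OF this exp_sums[of t]]
  have "(\<lambda>i. real (Suc i) * (t ^ i / fact i)) sums ((t + 1) * exp t)"
    by (simp add: algebra_simps add_divide_distrib)
  moreover have "(deriv (weyl_f (Suc i)) x)\<^sup>2 = real (Suc i) * (t ^ i / fact i)" for i
    by (simp add: t_def deriv_weyl_f divide_simps power2_eq_square power_mult_distrib
        del: of_nat_Suc)
  ultimately have "(\<lambda>i. (deriv (weyl_f (Suc i)) x)\<^sup>2) sums ((t + 1) * exp t)"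
    by simp
  from sums_Suc[OF this] show ?thesis
    by (simp add: deriv_weyl_f t_def)
qed

theorem theorem3p1:
  fixes x :: real
  shows "(\<lambda>n. weyl_g n x) \<longlonglongrightarrow> 1 / pi"
proof -
  define e where "e = exp (x\<^sup>2)"
  have e: "e > 0"
    by (simp add: e_def)
  \<comment> \<open>This form of \<open>sums\<close> has the inclusive upper bound \<open>n\<close>,
    matching the sums in \<open>weyl_g\<close>.\<close>
  note partial_sums = sums_def_le[THEN iffD1, unfolded atMost_atLeast0]
  have "(\<lambda>n. weyl_g n x) \<longlonglongrightarrow>
      sqrt ((x\<^sup>2 + 1) * e * e - (x * e)\<^sup>2) / (pi * e)"
    unfolding weyl_g_def e_def
    \<comment> \<open>The final \<open>simp\<close> proves that the limit of the denominator is
      nonzero.\<close>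
    by (intro tendsto_intros partial_sums weyl_f_sq_sums weyl_f_deriv_sums deriv_weyl_f_sq_sums) simp
  moreover have "(x\<^sup>2 + 1) * e * e - (x * e)\<^sup>2 = e\<^sup>2"
    by (simp add: algebra_simps power2_eq_square)
  ultimately show ?thesis
    using e by simp
qed

end
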